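(* Let $A\in\mathbb{R}^{n\times n}$, $B\in\mathbb{R}^{n\times m}$, $C\in\mathbb{R}^{m\times n}$, and consider the linear system $$\dot{x}(t)=Ax(t)+Bu(t)+d(t),\qquad y(t)=Cx(t)+\eta(t),$$ with the distributed controller $$\dot z_i(t)=(r_i-y_i(t))-\gamma\sum_{j\in\mathcal{N}_i}c_{ij}\,(z_i(t)-z_j(t)),\qquad u_i(t)=K^P_i\,(r_i-y_i(t))+K^I_i\,z_i(t),\qquad i=1,\dots,m,$$ where $K^P_i>0$, $K^I_i>0$, $\gamma>0$, $c_{ij}=c_{ji}>0$ for $j\in\mathcal{N}_i$, and $r\in\mathbb{R}^m$ is a constant reference. Let $K^P=\operatorname{diag}(K^P_1,\dots,K^P_m)$, $K^I=\operatorname{diag}(K^I_1,\dots,K^I_m)$, and let $\mathcal{L}_c$ be the weighted Laplacian of the communication graph with weights $c_{ij}$. Assume that the closed-loop system is output stable for the given $K^P,K^I,\mathcal{L}_c,\gamma$, i.e. all observable modes of $(F,[C,\,0_{m\times m}])$ are stable, where $$F=\begin{bmatrix} A-BK^PC & BK^I\\ -C & -\gamma\mathcal{L}_c\end{bmatrix}.$$ Assume furthermore that $\eta(t)=0$ and $d(t)=d$ is constant. If there exist $k\in\mathbb{R}$ and $x\in\mathbb{R}^n$ such that $Ax-kBK^I1_{m\times 1}+d$ is an unobservable mode of $(A,C)$ and $Cx=r$, then the steady-state output error satisfies $e_0=0$.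
   Context: Here $x(t)\in\mathbb{R}^n$ is the state, $u(t)\in\mathbb{R}^m$ the input, $y(t)\in\mathbb{R}^m$ the output, $d(t)\in\mathbb{R}^n$ a disturbance, $\eta(t)\in\mathbb{R}^m$ measurement noise, and $z(t)\in\mathbb{R}^m$ the integral states of the controller. The communication graph $\mathcal{G}=(\mathcal{V},\mathcal{E})$ is an undirected connected graph on the nodes $\{1,\dots,m\}$ (node $i$ is the $i$-th sensor/actuator pair), and $\mathcal{N}_i$ is the set of neighbors of node $i$. The weighted Laplacian $\mathcal{L}_c$ has entries $\mathcal{L}_{c,ii}=\sum_{j\in\mathcal{N}_i}c_{ij}$, $\mathcal{L}_{c,ij}=-c_{ij}$ if $j\in\mathcal{N}_i$, and $\mathcal{L}_{c,ij}=0$ otherwise ($j\neq i$). The output error is $e(t)=r-y(t)$, and $e_0=\lim_{t\to\infty}e(t)$. $1_{m\times 1}$ denotes the all-ones vector. A vector $v\in\mathbb{R}^n$ is called an unobservable mode of $(A,C)$ if it lies in the unobservable subspace, i.e. $CA^jv=0$ for $j=0,\dots,n-1$ (the kernel of the observability matrix). "All observable modes of $(F,[C,0_{m\times m}])$ are stable" means that the dynamics induced by $F$ on the quotient of the state space $\mathbb{R}^{n+m}$ by the unobservable subspace of $(F,[C,0_{m\times m}])$ have all eigenvalues with strictly negative real part. *)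

theory Defs
  imports "HOL-Analysis.Analysis"
begin

definition diag_mat :: "real ^ 'm \<Rightarrow> real ^ 'm ^ 'm" where
  "diag_mat v = (\<chi> i j. if i = j then v $ i else 0)"

text \<open>The state space of the closed loop is indexed by the sum type: index
  \<open>Inl\<close> for the plant states, \<open>Inr\<close> for the integral states of the controller.\<close>

definition block_mat ::
  "real ^ 'n ^ 'n \<Rightarrow> real ^ 'm ^ 'n \<Rightarrow> real ^ 'n ^ 'm \<Rightarrow> real ^ 'm ^ 'm
    \<Rightarrow> real ^ ('n + 'm) ^ ('n + 'm)" where
  "block_mat P Q R S = (\<chi> i j.
     case i of
       Inl a \<Rightarrow> (case j of Inl b \<Rightarrow> P $ a $ b | Inr b \<Rightarrow> Q $ a $ b)
     | Inr a \<Rightarrow> (case j of Inl b \<Rightarrow> R $ a $ b | Inr b \<Rightarrow> S $ a $ b))"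

definition block_row :: "real ^ 'n ^ 'p \<Rightarrow> real ^ 'm ^ 'p \<Rightarrow> real ^ ('n + 'm) ^ 'p" where
  "block_row P Q = (\<chi> i j. case j of Inl b \<Rightarrow> P $ i $ b | Inr b \<Rightarrow> Q $ i $ b)"

text \<open>Communication graphs are simple graphs on the whole index type, given by a symmetric
  set of ordered pairs.\<close>

definition connected_graph :: "('m \<times> 'm) set \<Rightarrow> bool" where
  "connected_graph E \<longleftrightarrow> sym E \<and> irrefl E \<and> (\<forall>i j. (i, j) \<in> E\<^sup>*)"

definition nbrs :: "('m \<times> 'm) set \<Rightarrow> 'm \<Rightarrow> 'm set" where
  "nbrs E i = {j. (i, j) \<in> E}"

definition weighted_laplacian ::
  "('m \<times> 'm) set \<Rightarrow> ('m \<Rightarrow> 'm \<Rightarrow> real) \<Rightarrow> real ^ 'm ^ 'm" where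
  "weighted_laplacian E c = (\<chi> i j.
     if i = j then (\<Sum>l\<in>nbrs E i. c i l)
     else if j \<in> nbrs E i then - c i j else 0)"

definition unobservable_subspace ::
  "real ^ 'n ^ 'n \<Rightarrow> real ^ 'n ^ 'p \<Rightarrow> (real ^ 'n) set" where
  "unobservable_subspace A C = {v. \<forall>j<CARD('n). C *v (((*v) A ^^ j) v) = 0}"

definition complexification :: "(real ^ 'n) set \<Rightarrow> (complex ^ 'n) set" where
  "complexification N = {v. (\<chi> i. Re (v $ i)) \<in> N \<and> (\<chi> i. Im (v $ i)) \<in> N}"

definition complex_mat :: "real ^ 'n ^ 'm \<Rightarrow> complex ^ 'n ^ 'm" where
  "complex_mat A = (\<chi> i j. complex_of_real (A $ i $ j))"

text \<open>For an \<open>F\<close>-invariant subspace \<open>N\<close>, \<open>\<mu>\<close> is an eigenvalue of the map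
  \<open>v + N \<mapsto> F v + N\<close> induced on the complexified quotient space iff some nonzero coset \<open>v + N\<close>
  satisfies \<open>F v + N = \<mu> v + N\<close>.\<close>

definition quotient_eigenvalue ::
  "real ^ 'n ^ 'n \<Rightarrow> (real ^ 'n) set \<Rightarrow> complex \<Rightarrow> bool" where
  "quotient_eigenvalue F N \<mu> \<longleftrightarrow>
     (\<exists>v. v \<notin> complexification N \<and> complex_mat F *v v - \<mu> *s v \<in> complexification N)"

definition observable_modes_stable :: "real ^ 'n ^ 'n \<Rightarrow> real ^ 'n ^ 'p \<Rightarrow> bool" where
  "observable_modes_stable F H \<longleftrightarrow>
     (\<forall>\<mu>. quotient_eigenvalue F (unobservable_subspace F H) \<mu> \<longrightarrow> Re \<mu> < 0)"

definition closed_loop_matrix ::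
  "real ^ 'n ^ 'n \<Rightarrow> real ^ 'm ^ 'n \<Rightarrow> real ^ 'n ^ 'm \<Rightarrow> real ^ 'm \<Rightarrow> real ^ 'm \<Rightarrow> real
    \<Rightarrow> real ^ 'm ^ 'm \<Rightarrow> real ^ ('n + 'm) ^ ('n + 'm)" where
  "closed_loop_matrix A B C kP kI \<gamma> L =
     block_mat (A - B ** diag_mat kP ** C) (B ** diag_mat kI) (- C) (- (\<gamma> *\<^sub>R L))"

definition output_stable ::
  "real ^ 'n ^ 'n \<Rightarrow> real ^ 'm ^ 'n \<Rightarrow> real ^ 'n ^ 'm \<Rightarrow> real ^ 'm \<Rightarrow> real ^ 'm \<Rightarrow> real
    \<Rightarrow> real ^ 'm ^ 'm \<Rightarrow> bool" where
  "output_stable A B C kP kI \<gamma> L \<longleftrightarrow>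
     observable_modes_stable (closed_loop_matrix A B C kP kI \<gamma> L)
       (block_row C (0 :: real ^ 'm ^ 'm))"

definition plant ::
  "real ^ 'n ^ 'n \<Rightarrow> real ^ 'm ^ 'n \<Rightarrow> real ^ 'n ^ 'm
    \<Rightarrow> (real \<Rightarrow> real ^ 'n) \<Rightarrow> (real \<Rightarrow> real ^ 'm)
    \<Rightarrow> (real \<Rightarrow> real ^ 'n) \<Rightarrow> (real \<Rightarrow> real ^ 'm) \<Rightarrow> (real \<Rightarrow> real ^ 'm) \<Rightarrow> bool" where
  "plant A B C d \<eta> x u y \<longleftrightarrow> (\<forall>t\<ge>0.
     (x has_vector_derivative (A *v x t + B *v u t + d t)) (at t within {0..}) \<and>
     y t = C *v x t + \<eta> t)"

definition distributed_controller ::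
  "('m \<times> 'm) set \<Rightarrow> ('m \<Rightarrow> 'm \<Rightarrow> real) \<Rightarrow> real \<Rightarrow> real ^ 'm \<Rightarrow> real ^ 'm \<Rightarrow> real ^ 'm
    \<Rightarrow> (real \<Rightarrow> real ^ 'm) \<Rightarrow> (real \<Rightarrow> real ^ 'm) \<Rightarrow> (real \<Rightarrow> real ^ 'm) \<Rightarrow> bool" where
  "distributed_controller E c \<gamma> kP kI r y z u \<longleftrightarrow> (\<forall>t\<ge>0. \<forall>i.
     ((\<lambda>s. z s $ i) has_real_derivative
        ((r $ i - y t $ i) - \<gamma> * (\<Sum>j\<in>nbrs E i. c i j * (z t $ i - z t $ j))))
       (at t within {0..}) \<and>
     u t $ i = kP $ i * (r $ i - y t $ i) + kI $ i * z t $ i)"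

end

theory Submission
  imports Defs "HOL-Computational_Algebra.Fundamental_Theorem_Algebra"
begin

text \<open>The hypothesis supplies an ideal equilibrium: a state \<open>xs\<close> with \<open>C xs = r\<close> and integral states
  \<open>- k 1\<close>, all equal, so that the coupling term of the controller vanishes. It need not be an
  equilibrium of the plant, but the residual drift \<open>w = A xs - k B K\<^sup>I 1 + d\<close> is invisible in the
  output. Measured from this point, \<open>W = (x - xs, z + k 1)\<close> obeys \<open>W' = F W + (w, 0)\<close> and the output
  error is \<open>r - y = - [C, 0] W\<close>. The vector \<open>(w, 0)\<close> lies in the unobservable subspace \<open>N\<close> of
  \<open>(F, [C, 0])\<close>, because \<open>F\<close> acts as \<open>A\<close> on vectors \<open>(v, 0)\<close> with \<open>C v = 0\<close>
  (lemma \<open>plant_unobservable_closed_loop\<close>). Hence \<open>W\<close> solves an autonomous linear equation modulo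
  \<open>N\<close>, and the matrix induced there is stable.

  It remains to see that the output of such an equation tends to zero (lemma
  \<open>observable_output_decay\<close>). Some polynomial \<open>p \<noteq> 0\<close> annihilates \<open>F\<close>, so over the complex numbers \<open>p(F) W\<close> stays in \<open>N\<close>. The
  roots of \<open>p\<close> are removed one at a time (lemma \<open>stable_quotient_output_decay\<close>). If a root \<open>\<mu>\<close> is
  not an eigenvalue on the quotient, \<open>F - \<mu>\<close> is injective modulo \<open>N\<close> and the factor is cancelled.
  If it is one, then \<open>Re \<mu> < 0\<close>, the signal \<open>(F - \<mu>) W\<close> satisfies an equation of the same form with a
  polynomial of smaller degree, and the output \<open>h\<close> satisfies the scalar equation
  \<open>(h W)' = \<mu> (h W) + h ((F - \<mu>) W)\<close>, whose forcing tends to zero by induction; the scalar lemma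
  \<open>forced_decay\<close> concludes.

  Both the annihilating polynomial and the invariance of the unobservable subspace, which is defined
  by finitely many powers only, come from the Krylov sequence \<open>v, f v, f (f v), \<dots>\<close>: within the
  dimension of the space, one of its vectors depends linearly on its predecessors.\<close>

section \<open>Krylov sequences\<close>

lemma krylov_dependence:
  fixes f :: "'a::euclidean_space \<Rightarrow> 'a"
  shows "\<exists>j\<le>DIM('a). (f ^^ j) v \<in> span ((\<lambda>i. (f ^^ i) v) ` {..<j})"
proof (rule ccontr)
  assume neg: "\<not> ?thesis"
  \<comment> \<open>Otherwise every initial segment is independent, and one has more vectors than the dimension.\<close>
  have "j \<le> Suc (DIM('a)) \<Longrightarrow> independent ((\<lambda>i. (f ^^ i) v) ` {..<j}) \<and> card ((\<lambda>i. (f ^^ i) v) ` {..<j}) = j" for j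
  proof (induction j)
    case 0
    then show ?case by (simp add: independent_empty)
  next
    case (Suc j)
    have nin: "(f ^^ j) v \<notin> span ((\<lambda>i. (f ^^ i) v) ` {..<j})"
      using neg Suc.prems by auto
    then have "(f ^^ j) v \<notin> (\<lambda>i. (f ^^ i) v) ` {..<j}"
      by (rule contrapos_nn) (rule span_base)
    with nin Suc show ?case
      by (simp add: lessThan_Suc independent_insert)
  qed
  from this[of "Suc (DIM('a))"] show False
    using independent_bound by fastforce
qed

text \<open>Once a vector depends on its predecessors, the span of the latter is mapped into itself, so the
  sequence never leaves it.\<close>

lemma krylov_span_invariant:
  fixes f :: "'a::real_vector \<Rightarrow> 'a"
  assumes f: "linear f"
    and j: "(f ^^ j) v \<in> span ((\<lambda>i. (f ^^ i) v) ` {..<j})"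
  shows "(f ^^ k) v \<in> span ((\<lambda>i. (f ^^ i) v) ` {..<j})"
proof (cases "j = 0")
  case True
  with j have "v = 0" by simp
  moreover have "(f ^^ k) 0 = 0" by (induction k) (auto simp: linear_0[OF f])
  ultimately show ?thesis by (simp add: span_zero)
next
  case False
  let ?S = "(\<lambda>i. (f ^^ i) v) ` {..<j}"
  have "f ` ?S \<subseteq> span ?S"
  proof clarsimp
    fix i assume "i < j"
    then consider "Suc i < j" | "Suc i = j" by linarith
    then show "f ((f ^^ i) v) \<in> span ?S"
    proof cases
      case 1
      then have "(f ^^ Suc i) v \<in> ?S" by blast
      then have "(f ^^ Suc i) v \<in> span ?S" by (rule span_base)
      then show ?thesis by simp
    next
      case 2
      then show ?thesis using j by auto
    qed
  qed
  then have inv: "f ` span ?S \<subseteq> span ?S"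
    by (metis linear_span_image[OF f] span_minimal subspace_span)
  show ?thesis
  proof (induction k)
    case 0
    have "(f ^^ 0) v \<in> ?S" using False by blast
    then show ?case by (rule span_base)
  next
    case (Suc k)
    then show ?case using inv by auto
  qed
qed

text \<open>The coefficients are indexed by positions rather than by vectors, since \<open>b\<close> may repeat values.\<close>

lemma span_sequence_coeffs:
  fixes b :: "nat \<Rightarrow> 'a::real_vector"
  assumes "x \<in> span (b ` {..<j})"
  shows "\<exists>c. x = (\<Sum>i<j. c i *\<^sub>R b i)"
  using assms
proof (induction j arbitrary: x)
  case 0
  then show ?case by simp
next
  case (Suc j)
  then obtain k where "x - k *\<^sub>R b j \<in> span (b ` {..<j})"
    by (auto simp: lessThan_Suc span_breakdown_eq)
  then obtain c where c: "x - k *\<^sub>R b j = (\<Sum>i<j. c i *\<^sub>R b i)"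
    using Suc.IH by blast
  have "x = (\<Sum>i<Suc j. (c(j := k)) i *\<^sub>R b i)"
    using c by (simp add: algebra_simps)
  then show ?case by blast
qed

section \<open>The unobservable subspace\<close>

text \<open>The output along the Krylov sequence of \<open>v\<close> vanishes on an initial segment that spans the rest.\<close>

lemma unobservable_all_powers:
  fixes A :: "real ^ 'n ^ 'n" and C :: "real ^ 'n ^ 'p"
  assumes "v \<in> unobservable_subspace A C"
  shows "C *v (((*v) A ^^ k) v) = 0"
proof -
  let ?K = "\<lambda>j. (\<lambda>i. ((*v) A ^^ i) v) ` {..<j}"
  obtain j where j: "j \<le> CARD('n)" "((*v) A ^^ j) v \<in> span (?K j)"
    using krylov_dependence[of "(*v) A" v] by auto
  have "subspace {u. C *v u = 0}"
    by (simp add: subspace_def matrix_vector_right_distrib matrix_vector_mult_scaleR)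
  moreover have "?K j \<subseteq> {u. C *v u = 0}"
    using assms j(1) by (auto simp: unobservable_subspace_def)
  ultimately have "span (?K j) \<subseteq> {u. C *v u = 0}"
    by (rule span_minimal[rotated])
  then show ?thesis
    using krylov_span_invariant[OF matrix_vector_mul_linear j(2), of k] by blast
qed

lemma subspace_unobservable: "subspace (unobservable_subspace A C)"
proof -
  have "((*v) A ^^ j) (a + b) = ((*v) A ^^ j) a + ((*v) A ^^ j) b"
    "((*v) A ^^ j) (s *\<^sub>R a) = s *\<^sub>R ((*v) A ^^ j) a"  "((*v) A ^^ j) 0 = 0" for j a b s
    by (induction j) (auto simp: matrix_vector_right_distrib matrix_vector_mult_scaleR)
  then show ?thesis
    by (simp add: subspace_def unobservable_subspace_def matrix_vector_right_distrib matrix_vector_mult_scaleR)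
qed

lemma unobservable_invariant:
  assumes "v \<in> unobservable_subspace A C"
  shows "A *v v \<in> unobservable_subspace A C"
  using unobservable_all_powers[OF assms, of "Suc _"]
  by (simp add: unobservable_subspace_def funpow_swap1)

section \<open>Scalar equations with vanishing forcing\<close>

text \<open>An energy estimate. With \<open>a = - Re \<mu>\<close>, the function \<open>v = |y|\<^sup>2\<close> satisfies
  \<open>v' \<le> - a v + |f|\<^sup>2 / a\<close> by the inequality of arithmetic and geometric means, and such a \<open>v\<close> is
  driven below any level \<open>e\<close> with \<open>|f|\<^sup>2 < a\<^sup>2 e\<close> at exponential rate.\<close>

lemma forced_decay:
  fixes y f :: "real \<Rightarrow> complex"
  assumes der: "\<And>t. t \<ge> 0 \<Longrightarrow> (y has_vector_derivative (\<mu> * y t + f t)) (at t within {0..})"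
    and \<mu>: "Re \<mu> < 0"
    and f: "(f \<longlongrightarrow> 0) at_top"
  shows "(y \<longlongrightarrow> 0) at_top"
proof -
  define a where "a = - Re \<mu>"
  define v where "v t = y t \<bullet> y t" for t
  have a: "a > 0" using \<mu> by (simp add: a_def)
  have dv: "\<exists>v'. (v has_real_derivative v') (at t) \<and> v' \<le> - a * v t + (norm (f t))\<^sup>2 / a"
    if "t > 0" for t
  proof -
    have "at t within {0..} = at t"
      using that by (intro at_within_interior) (auto simp: interior_real_atLeast)
    then have "(y has_vector_derivative (\<mu> * y t + f t)) (at t)"
      using der[of t] that by simp
    then have "(v has_real_derivative (2 * (y t \<bullet> (\<mu> * y t + f t)))) (at t)"
      unfolding v_def has_real_derivative_iff_has_vector_derivative has_vector_derivative_def
      by (auto intro!: derivative_eq_intros simp: inner_commute algebra_simps)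
    moreover have "2 * (y t \<bullet> (\<mu> * y t + f t)) \<le> - a * v t + (norm (f t))\<^sup>2 / a"
    proof -
      have 1: "y t \<bullet> (\<mu> * y t) = - a * v t"
        by (simp add: inner_complex_def v_def a_def algebra_simps)
      have "y t \<bullet> f t \<le> norm (y t) * norm (f t)" by (rule norm_cauchy_schwarz)
      moreover have "2 * (norm (y t) * norm (f t)) \<le> a * v t + (norm (f t))\<^sup>2 / a"
      proof -
        have "0 \<le> (a * norm (y t) - norm (f t))\<^sup>2 / a" using a by simp
        also have "\<dots> = a * v t + (norm (f t))\<^sup>2 / a - 2 * (norm (y t) * norm (f t))"
          using a by (simp add: v_def dot_square_norm power2_eq_square field_simps)
        finally show ?thesis by simp
      qed
      ultimately show ?thesis by (simp add: inner_add_right 1 algebra_simps)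
    qed
    ultimately show ?thesis by blast
  qed
  have "(v \<longlongrightarrow> 0) at_top"
  proof (rule tendstoI)
    fix e' :: real assume "e' > 0"
    define e where "e = e' / 2"
    have e: "e > 0" using \<open>e' > 0\<close> by (simp add: e_def)
    have "((\<lambda>t. (norm (f t))\<^sup>2) \<longlongrightarrow> 0) at_top"
      using tendsto_power[OF tendsto_norm[OF f], of 2] by simp
    then have "eventually (\<lambda>t. (norm (f t))\<^sup>2 < a * a * e) at_top"
      by (rule order_tendstoD(2)) (use a e in simp)
    then obtain T0 where T0: "\<And>t. t \<ge> T0 \<Longrightarrow> (norm (f t))\<^sup>2 < a * a * e"
      by (auto simp: eventually_at_top_linorder)
    \<comment> \<open>\<open>T > 0\<close> avoids the left end of the time axis, where the derivative is only one-sided.\<close>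
    define T where "T = max T0 1"
    \<comment> \<open>The integrating factor makes the excess of \<open>v\<close> over the level \<open>e\<close> nonincreasing.\<close>
    define \<phi> where "\<phi> t = exp (a * t) * (v t - e)" for t
    have mono: "\<phi> t \<le> \<phi> T" if "t \<ge> T" for t
    proof (rule DERIV_nonpos_imp_nonincreasing[OF that])
      fix s assume s: "T \<le> s" "s \<le> t"
      then have "s > 0" by (simp add: T_def)
      then obtain v' where v': "(v has_real_derivative v') (at s)"
        "v' \<le> - a * v s + (norm (f s))\<^sup>2 / a"
        using dv by blast
      have "(norm (f s))\<^sup>2 / a \<le> a * e"
        using T0[of s] s a by (simp add: T_def field_simps)
      then have "exp (a * s) * (a * (v s - e) + v') \<le> 0"
        using v'(2) by (intro mult_nonneg_nonpos) (auto simp: algebra_simps)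
      moreover have "(\<phi> has_real_derivative exp (a * s) * (a * (v s - e) + v')) (at s)"
        unfolding \<phi>_def by (auto intro!: derivative_eq_intros v'(1) simp: algebra_simps)
      ultimately show "\<exists>y. (\<phi> has_real_derivative y) (at s) \<and> y \<le> 0" by blast
    qed
    have "((\<lambda>t. exp (- (a * t)) * \<phi> T) \<longlongrightarrow> 0 * \<phi> T) at_top"
    proof (intro tendsto_intros)
      have "filterlim (\<lambda>t. - (a * t)) at_bot at_top"
        using a filterlim_tendsto_pos_mult_at_top[OF tendsto_const a filterlim_ident]
        by (simp add: filterlim_uminus_at_bot)
      then show "((\<lambda>t. exp (- (a * t))) \<longlongrightarrow> 0) at_top"
        using exp_at_bot filterlim_compose by blast
    qed
    then have "eventually (\<lambda>t. exp (- (a * t)) * \<phi> T < e) at_top"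
      by (rule order_tendstoD(2)) (use e in simp)
    then show "eventually (\<lambda>t. dist (v t) 0 < e') at_top"
      using eventually_ge_at_top[of T]
    proof eventually_elim
      case (elim t)
      have "v t - e = exp (- (a * t)) * \<phi> t"
        by (simp add: \<phi>_def exp_minus field_simps)
      also have "\<dots> \<le> exp (- (a * t)) * \<phi> T"
        using mono[OF elim(2)] by (intro mult_left_mono) auto
      finally show ?case using elim by (simp add: v_def e_def)
    qed
  qed
  then have "((\<lambda>t. sqrt (v t)) \<longlongrightarrow> 0) at_top"
    using tendsto_real_sqrt by fastforce
  then show ?thesis
    by (simp add: v_def norm_eq_sqrt_inner[symmetric] tendsto_norm_zero_iff)
qed

section \<open>Polynomials in a matrix\<close>

text \<open>The vector \<open>p(F) v\<close>. Only its values on vectors are used, so the powers of \<open>F\<close> are iterates of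
  the map.\<close>

definition poly_act :: "complex ^ 'n ^ 'n \<Rightarrow> complex poly \<Rightarrow> complex ^ 'n \<Rightarrow> complex ^ 'n" where
  "poly_act F p v = (\<Sum>i\<le>degree p. coeff p i *s ((*v) F ^^ i) v)"

lemma poly_act_upto:
  assumes "degree p \<le> n"
  shows "poly_act F p v = (\<Sum>i\<le>n. coeff p i *s ((*v) F ^^ i) v)"
  unfolding poly_act_def using assms
  by (intro sum.mono_neutral_left) (auto simp: coeff_eq_0)

text \<open>A linear factor can be applied last or first. The first form serves to cancel the factor, the
  second to pass to the signal \<open>(F - \<mu>) w\<close>.\<close>

lemma poly_act_linear_factor:
  "poly_act F ([:- \<mu>, 1:] * q) v = F *v poly_act F q v - \<mu> *s poly_act F q v" (is ?A)
  "poly_act F ([:- \<mu>, 1:] * q) v = poly_act F q (F *v v - \<mu> *s v)" (is ?B)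
proof -
  have pow: "((*v) F ^^ i) (F *v v - \<mu> *s v) = ((*v) F ^^ Suc i) v - \<mu> *s ((*v) F ^^ i) v" for i
    by (induction i) (auto simp: vec.diff vec.scale matrix_vector_mult_diff_distrib)
  have "degree ([:- \<mu>, 1:] * q) \<le> Suc (degree q)"
    using degree_mult_le[of "[:- \<mu>, 1:]" q] by simp
  then have "poly_act F ([:- \<mu>, 1:] * q) v
      = (\<Sum>i\<le>Suc (degree q). (coeff (pCons 0 q) i - \<mu> * coeff q i) *s ((*v) F ^^ i) v)"
    by (simp add: poly_act_upto)
  also have "\<dots> = (\<Sum>i\<le>Suc (degree q). coeff (pCons 0 q) i *s ((*v) F ^^ i) v)
       - \<mu> *s (\<Sum>i\<le>Suc (degree q). coeff q i *s ((*v) F ^^ i) v)"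
    by (simp only: vec.scale_left_diff_distrib sum_subtractf vec.scale_sum_right vec.scale_scale)
  also have "(\<Sum>i\<le>Suc (degree q). coeff (pCons 0 q) i *s ((*v) F ^^ i) v)
      = (\<Sum>i\<le>degree q. coeff q i *s ((*v) F ^^ Suc i) v)"
    by (subst sum.atMost_Suc_shift) simp
  also have "(\<Sum>i\<le>Suc (degree q). coeff q i *s ((*v) F ^^ i) v) = poly_act F q v"
    by (rule poly_act_upto[symmetric]) simp
  finally have *: "poly_act F ([:- \<mu>, 1:] * q) v
      = (\<Sum>i\<le>degree q. coeff q i *s ((*v) F ^^ Suc i) v) - \<mu> *s poly_act F q v" .
  then show ?A
    by (simp add: poly_act_def vec.sum vec.scale)
  show ?B
    unfolding * unfolding poly_act_def pow
    by (simp add: vec.scale_right_diff_distrib sum_subtractf vec.scale_sum_right mult.commute)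
qed


section \<open>Outputs of systems that are stable on a quotient\<close>

text \<open>Induction on the degree of \<open>p\<close>, generalized over the signal \<open>w\<close> and the input \<open>g\<close>, because
  splitting off a stable root \<open>\<mu>\<close> replaces them by \<open>(F - \<mu>) w\<close> and \<open>(F - \<mu>) g\<close>. Roots that are not
  eigenvalues on the quotient may have any real part; their factors are cancelled. The functional
  \<open>h\<close> sees neither \<open>N\<close> nor, consequently, the input.\<close>

lemma stable_quotient_output_decay:
  fixes F :: "complex ^ 'n ^ 'n" and h :: "complex ^ 'n \<Rightarrow> complex"
  assumes N: "vec.subspace N" and inv: "\<And>v. v \<in> N \<Longrightarrow> F *v v \<in> N"
    and stable: "\<And>\<mu> v. v \<notin> N \<Longrightarrow> F *v v - \<mu> *s v \<in> N \<Longrightarrow> Re \<mu> < 0"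
    and h: "bounded_linear h" "\<And>a v. h (a *s v) = a * h v" "\<And>v. v \<in> N \<Longrightarrow> h v = 0"
    and p: "p \<noteq> 0" "\<And>t. t \<ge> 0 \<Longrightarrow> poly_act F p (w t) \<in> N"
    and w: "\<And>t. t \<ge> 0 \<Longrightarrow> (w has_vector_derivative (F *v w t + g t)) (at t within {0..})"
    and g: "\<And>t. t \<ge> 0 \<Longrightarrow> g t \<in> N"
  shows "((\<lambda>t. h (w t)) \<longlongrightarrow> 0) at_top"
  using p w g
proof (induction "degree p" arbitrary: p w g)
  case 0
  then obtain a where a: "p = [:a:]" "a \<noteq> 0"
    by (metis degree_eq_zeroE pCons_0_0)
  have "h (w t) = 0" if "t \<ge> 0" for t
  proof -
    have "a *s w t \<in> N"
      using "0.prems"(2)[OF that] a by (simp add: poly_act_def)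
    then have "a * h (w t) = 0" using h(2,3) by metis
    then show ?thesis using a by simp
  qed
  then show ?case
    by (intro tendsto_eventually eventually_mono[OF eventually_ge_at_top[of 0]]) auto
next
  case (Suc d)
  obtain \<mu> where "poly p \<mu> = 0"
    using fundamental_theorem_of_algebra[of p] Suc.hyps(2) by (auto simp: constant_degree)
  then obtain q where q: "p = [:- \<mu>, 1:] * q"
    by (auto simp: poly_eq_0_iff_dvd)
  have q0: "q \<noteq> 0" using q Suc.prems(1) by auto
  have dq: "d = degree q"
    using Suc.hyps(2) q0 unfolding q by (subst (asm) degree_mult_eq) auto
  show ?case
  proof (cases "\<exists>v. v \<notin> N \<and> F *v v - \<mu> *s v \<in> N")
    case False
    have "poly_act F q (w t) \<in> N" if "t \<ge> 0" for t
      using False Suc.prems(2)[OF that] unfolding q poly_act_linear_factor(1) by blast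
    then show ?thesis
      using Suc.hyps(1)[OF dq q0, of w g] Suc.prems by blast
  next
    case True
    then have \<mu>: "Re \<mu> < 0" using stable by blast
    define D where "D v = F *v v - \<mu> *s v" for v
    have hadd: "h (u + v) = h u + h v" for u v
      using h(1) by (simp add: bounded_linear.linear linear_add)
    \<comment> \<open>Bounded linearity is a notion over the reals, whereas matrices act with complex scalars.\<close>
    have sR: "s *\<^sub>R v = complex_of_real s *s v" for s and v :: "complex ^ 'n"
      by (simp add: vec_eq_iff scaleR_vec_def scaleR_conv_of_real)
    have "linear D"
      unfolding D_def
      by (intro linearI)
        (simp_all add: sR vec.add vec.scale vec.scale_right_distrib vec.scale_right_diff_distrib mult.commute)
    then have "bounded_linear D" by (simp add: linear_conv_bounded_linear)
    have "((\<lambda>t. h (D (w t))) \<longlongrightarrow> 0) at_top"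
    proof (rule Suc.hyps(1)[OF dq q0, of "\<lambda>t. D (w t)" "\<lambda>t. D (g t)"])
      fix t :: real assume t: "t \<ge> 0"
      show "poly_act F q (D (w t)) \<in> N"
        using Suc.prems(2)[OF t] unfolding q poly_act_linear_factor(2) D_def .
      have "D (F *v w t + g t) = F *v D (w t) + D (g t)"
        by (simp add: D_def vec.add vec.diff vec.scale vec.scale_right_distrib)
      then show "((\<lambda>t. D (w t)) has_vector_derivative F *v D (w t) + D (g t)) (at t within {0..})"
        using bounded_linear.has_vector_derivative[OF \<open>bounded_linear D\<close> Suc.prems(3)[OF t]]
        by simp
      show "D (g t) \<in> N"
        unfolding D_def using Suc.prems(4)[OF t] inv
        by (intro vec.subspace_diff[OF N] vec.subspace_scale[OF N])
    qed
    moreover have "((\<lambda>t. h (w t)) has_vector_derivative (\<mu> * h (w t) + h (D (w t)))) (at t within {0..})"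
      if t: "t \<ge> 0" for t
    proof -
      have "F *v w t + g t = (D (w t) + \<mu> *s w t) + g t" by (simp add: D_def)
      then have "h (F *v w t + g t) = \<mu> * h (w t) + h (D (w t))"
        by (simp add: hadd h(2) h(3) Suc.prems(4)[OF t])
      then show ?thesis
        using bounded_linear.has_vector_derivative[OF h(1) Suc.prems(3)[OF t]] by simp
    qed
    ultimately show ?thesis
      by (rule forced_decay[OF _ \<mu>, rotated])
  qed
qed

section \<open>Real systems inside their complexification\<close>

definition cvec :: "real ^ 'n \<Rightarrow> complex ^ 'n" where
  "cvec v = (\<chi> i. complex_of_real (v $ i))"

lemma cvec_add: "cvec (u + v) = cvec u + cvec v"
  and cvec_scaleR: "cvec (s *\<^sub>R v) = complex_of_real s *s cvec v"
  by (simp_all add: cvec_def vec_eq_iff)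

lemma bounded_linear_cvec: "bounded_linear cvec"
  unfolding linear_conv_bounded_linear[symmetric]
  by (intro linearI) (simp_all add: cvec_def vec_eq_iff scaleR_vec_def scaleR_conv_of_real)

lemma complex_mat_cvec: "complex_mat M *v cvec v = cvec (M *v v)"
  by (simp add: cvec_def complex_mat_def matrix_vector_mult_def vec_eq_iff)

lemma complex_mat_parts:
  "(\<chi> i. Re ((complex_mat M *v v) $ i)) = M *v (\<chi> i. Re (v $ i))"
  "(\<chi> i. Im ((complex_mat M *v v) $ i)) = M *v (\<chi> i. Im (v $ i))"
  by (simp_all add: complex_mat_def matrix_vector_mult_def vec_eq_iff)

lemma cvec_mem_complexification:
  assumes "subspace N" "v \<in> N"
  shows "cvec v \<in> complexification N"
proof -
  have "(\<chi> i. 0) = (0 :: real ^ 'a)" by (simp add: vec_eq_iff)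
  then show ?thesis
    using assms by (simp add: complexification_def cvec_def subspace_0)
qed

lemma subspace_complexification:
  assumes "subspace N"
  shows "vec.subspace (complexification N)"
proof -
  have "(\<chi> i. 0) = (0 :: real ^ 'a)" by (simp add: vec_eq_iff)
  moreover have "(\<chi> i. Re ((u + v) $ i)) = (\<chi> i. Re (u $ i)) + (\<chi> i. Re (v $ i))"
    "(\<chi> i. Im ((u + v) $ i)) = (\<chi> i. Im (u $ i)) + (\<chi> i. Im (v $ i))"
    "(\<chi> i. Re ((a *s u) $ i)) = Re a *\<^sub>R (\<chi> i. Re (u $ i)) - Im a *\<^sub>R (\<chi> i. Im (u $ i))"
    "(\<chi> i. Im ((a *s u) $ i)) = Re a *\<^sub>R (\<chi> i. Im (u $ i)) + Im a *\<^sub>R (\<chi> i. Re (u $ i))"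
    for u v :: "complex ^ 'a" and a
    by (simp_all add: vec_eq_iff)
  ultimately show ?thesis
    unfolding vec.subspace_def complexification_def mem_Collect_eq
    by (auto simp del: vector_add_component vector_smult_component
        intro: subspace_0 subspace_add subspace_diff subspace_scale assms)
qed

text \<open>The Krylov sequence of the identity under multiplication by \<open>F\<close> consists of the powers of \<open>F\<close>;
  a linear dependence among them is a monic polynomial that annihilates every vector at once. It is
  stated for vectors with real entries, the only ones along which trajectories run.\<close>

lemma annihilating_polynomial:
  fixes F :: "real ^ 'n ^ 'n"
  shows "\<exists>p. p \<noteq> 0 \<and> (\<forall>v. poly_act (complex_mat F) p (cvec v) = 0)"
proof -
  obtain j where "(((**) F) ^^ j) (mat 1) \<in> span ((\<lambda>i. (((**) F) ^^ i) (mat 1)) ` {..<j})"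
    using krylov_dependence[of "(**) F" "mat 1"] by blast
  then obtain c where c: "(((**) F) ^^ j) (mat 1) = (\<Sum>i<j. c i *\<^sub>R (((**) F) ^^ i) (mat 1))"
    using span_sequence_coeffs by blast
  have pow: "(((**) F) ^^ i) (mat 1) *v v = ((*v) F ^^ i) v" for i v
    by (induction i) (auto simp: matrix_vector_mul_assoc[symmetric])
  have cpow: "((*v) (complex_mat F) ^^ i) (cvec v) = cvec (((*v) F ^^ i) v)" for i v
    by (induction i) (auto simp: complex_mat_cvec)
  define p where "p = monom 1 j - (\<Sum>i<j. monom (complex_of_real (c i)) i)"
  have coeff_p: "coeff p i = (if i = j then 1 else if i < j then - complex_of_real (c i) else 0)" for i
    by (simp add: p_def coeff_sum)
  have "p \<noteq> 0" using coeff_p[of j] by auto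
  moreover have "poly_act (complex_mat F) p (cvec v) = 0" for v
  proof -
    have "degree p \<le> j" by (rule degree_le) (simp add: coeff_p)
    then have "poly_act (complex_mat F) p (cvec v) = (\<Sum>i\<le>j. coeff p i *s cvec (((*v) F ^^ i) v))"
      by (simp add: poly_act_upto cpow)
    also have "\<dots> = cvec (((*v) F ^^ j) v) - (\<Sum>i<j. complex_of_real (c i) *s cvec (((*v) F ^^ i) v))"
      by (simp add: lessThan_Suc_atMost[symmetric] coeff_p sum_negf)
    also have "(\<Sum>i<j. complex_of_real (c i) *s cvec (((*v) F ^^ i) v))
        = cvec (\<Sum>i<j. c i *\<^sub>R ((*v) F ^^ i) v)"
      by (simp add: linear_sum[OF bounded_linear.linear[OF bounded_linear_cvec]] cvec_scaleR)
    also have "(\<Sum>i<j. c i *\<^sub>R ((*v) F ^^ i) v) = ((*v) F ^^ j) v"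
    proof -
      have "((*v) F ^^ j) v = (\<Sum>i<j. c i *\<^sub>R (((**) F) ^^ i) (mat 1)) *v v"
        by (simp add: pow[symmetric] c)
      also have "\<dots> = (\<Sum>i<j. c i *\<^sub>R ((((**) F) ^^ i) (mat 1) *v v))"
        by (induction j) (simp_all add: matrix_vector_mult_add_rdistrib scaleR_matrix_vector_assoc)
      finally show ?thesis by (simp add: pow)
    qed
    finally show ?thesis by simp
  qed
  ultimately show ?thesis by blast
qed

text \<open>Each component of the output is a functional that vanishes on the complexified unobservable
  subspace, so the complex result applies to it.\<close>

lemma observable_output_decay:
  fixes F :: "real ^ 'n ^ 'n" and H :: "real ^ 'n ^ 'p"
  assumes stable: "observable_modes_stable F H"
    and W: "\<And>t. t \<ge> 0 \<Longrightarrow> (W has_vector_derivative (F *v W t + g t)) (at t within {0..})"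
    and g: "\<And>t. t \<ge> 0 \<Longrightarrow> g t \<in> unobservable_subspace F H"
  shows "((\<lambda>t. H *v W t) \<longlongrightarrow> 0) at_top"
proof (rule vec_tendstoI)
  fix k
  let ?N = "unobservable_subspace F H"
  let ?M = "complexification ?N"
  obtain p where p: "p \<noteq> 0" "\<And>v. poly_act (complex_mat F) p (cvec v) = 0"
    using annihilating_polynomial by blast
  define h where "h v = (complex_mat H *v v) $ k" for v
  have M: "vec.subspace ?M"
    by (rule subspace_complexification[OF subspace_unobservable])
  have "((\<lambda>t. h (cvec (W t))) \<longlongrightarrow> 0) at_top"
  proof (rule stable_quotient_output_decay[OF M])
    show "complex_mat F *v v \<in> ?M" if "v \<in> ?M" for v
      using that by (simp add: complexification_def complex_mat_parts unobservable_invariant)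
    show "Re \<mu> < 0" if "v \<notin> ?M" "complex_mat F *v v - \<mu> *s v \<in> ?M" for \<mu> v
      using stable that unfolding observable_modes_stable_def quotient_eigenvalue_def by blast
    have "linear h"
      unfolding h_def by (intro linearI)
        (auto simp: matrix_vector_mult_def algebra_simps sum.distrib scaleR_sum_right)
    then show "bounded_linear h" by (simp add: linear_conv_bounded_linear)
    show "h (a *s v) = a * h v" for a v
      by (simp add: h_def vec.scale)
    show "h v = 0" if "v \<in> ?M" for v
    proof -
      have "H *v (\<chi> i. Re (v $ i)) = 0" "H *v (\<chi> i. Im (v $ i)) = 0"
        using that unobservable_all_powers[of _ F H 0] by (simp_all add: complexification_def)
      then have "(\<chi> i. Re ((complex_mat H *v v) $ i)) = 0" "(\<chi> i. Im ((complex_mat H *v v) $ i)) = 0"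
        by (simp_all only: complex_mat_parts)
      then show ?thesis by (simp add: h_def vec_eq_iff complex_eq_iff)
    qed
    show "p \<noteq> 0" by fact
    fix t :: real assume t: "t \<ge> 0"
    show "poly_act (complex_mat F) p (cvec (W t)) \<in> ?M"
      by (simp add: p vec.subspace_0[OF M])
    show "((\<lambda>t. cvec (W t)) has_vector_derivative complex_mat F *v cvec (W t) + cvec (g t)) (at t within {0..})"
      using bounded_linear.has_vector_derivative[OF bounded_linear_cvec W[OF t]]
      by (simp add: cvec_add complex_mat_cvec)
    show "cvec (g t) \<in> ?M"
      by (rule cvec_mem_complexification[OF subspace_unobservable g[OF t]])
  qed
  then have "((\<lambda>t. Re (h (cvec (W t)))) \<longlongrightarrow> 0) at_top"
    using tendsto_Re by fastforce
  then show "((\<lambda>t. (H *v W t) $ k) \<longlongrightarrow> 0 $ k) at_top"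
    by (simp add: h_def complex_mat_cvec) (simp add: cvec_def)
qed

section \<open>Block vectors and the closed loop\<close>

definition vjoin :: "real ^ 'n \<Rightarrow> real ^ 'm \<Rightarrow> real ^ ('n + 'm)" where
  "vjoin a b = (\<chi> i. case i of Inl j \<Rightarrow> a $ j | Inr j \<Rightarrow> b $ j)"

lemma vjoin_add: "vjoin a b + vjoin a' b' = vjoin (a + a') (b + b')"
  by (simp add: vjoin_def vec_eq_iff split: sum.split)

lemma sum_UNIV_Plus:
  fixes f :: "'n::finite + 'm::finite \<Rightarrow> 'b::comm_monoid_add"
  shows "sum f UNIV = (\<Sum>i\<in>UNIV. f (Inl i)) + (\<Sum>i\<in>UNIV. f (Inr i))"
  using sum.Plus[of "UNIV :: 'n set" "UNIV :: 'm set" f] by (simp add: o_def)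

lemma block_mat_vjoin:
  "block_mat P Q R S *v vjoin a b = vjoin (P *v a + Q *v b) (R *v a + S *v b)"
  by (simp add: vec_eq_iff block_mat_def vjoin_def matrix_vector_mult_def sum_UNIV_Plus split: sum.split)

lemma block_row_vjoin: "block_row P Q *v vjoin a b = P *v a + Q *v b"
  by (simp add: vec_eq_iff block_row_def vjoin_def matrix_vector_mult_def sum_UNIV_Plus)

lemma vjoin_has_vector_derivative:
  fixes a :: "real \<Rightarrow> real ^ 'n" and b :: "real \<Rightarrow> real ^ 'm"
  assumes "(a has_vector_derivative a') (at t within S)" "(b has_vector_derivative b') (at t within S)"
  shows "((\<lambda>t. vjoin (a t) (b t)) has_vector_derivative vjoin a' b') (at t within S)"
proof -
  have "linear (\<lambda>v. vjoin v (0 :: real ^ 'm))" "linear (\<lambda>v. vjoin (0 :: real ^ 'n) v)"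
    by (auto intro!: linearI simp: vjoin_def vec_eq_iff split: sum.split)
  then have "bounded_linear (\<lambda>v. vjoin v (0 :: real ^ 'm))" "bounded_linear (\<lambda>v. vjoin (0 :: real ^ 'n) v)"
    by (simp_all add: linear_conv_bounded_linear)
  from has_vector_derivative_add[OF bounded_linear.has_vector_derivative[OF this(1) assms(1)]
      bounded_linear.has_vector_derivative[OF this(2) assms(2)]]
  show ?thesis by (simp add: vjoin_add)
qed

lemma vec_has_vector_derivative:
  fixes f :: "real \<Rightarrow> real ^ 'm"
  assumes "\<And>i. ((\<lambda>s. f s $ i) has_real_derivative f' $ i) (at t within S)"
  shows "(f has_vector_derivative f') (at t within S)"
  unfolding has_vector_derivative_def
proof (subst has_derivative_componentwise_within, intro ballI)
  fix b :: "real ^ 'm" assume "b \<in> Basis"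
  then obtain i where b: "b = axis i 1" by (auto simp: Basis_vec_def)
  show "((\<lambda>x. f x \<bullet> b) has_derivative (\<lambda>x. (x *\<^sub>R f') \<bullet> b)) (at t within S)"
    using assms[of i] by (simp add: b cart_eq_inner_axis has_field_derivative_def mult_commute_abs)
qed

text \<open>The Laplacian as the coupling term of the controller. In this form it is manifest that adding a
  common constant to all entries has no effect.\<close>

lemma weighted_laplacian_apply:
  fixes E :: "('m::finite \<times> 'm) set"
  assumes "irrefl E"
  shows "(weighted_laplacian E c *v v) $ i = (\<Sum>j\<in>nbrs E i. c i j * (v $ i - v $ j))"
proof -
  have i: "i \<notin> nbrs E i" using assms by (auto simp: nbrs_def irrefl_def)
  have "(weighted_laplacian E c *v v) $ i
      = (\<Sum>j\<in>UNIV. (if j = i then (\<Sum>l\<in>nbrs E i. c i l) * v $ i else 0)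
          - (if j \<in> nbrs E i then c i j * v $ j else 0))"
    unfolding matrix_vector_mult_def weighted_laplacian_def
    by (auto intro!: sum.cong simp: i)
  also have "\<dots> = (\<Sum>l\<in>nbrs E i. c i l) * v $ i - (\<Sum>j\<in>nbrs E i. c i j * v $ j)"
    by (simp add: sum_subtractf sum.inter_restrict[of UNIV, simplified, symmetric])
  finally show ?thesis
    by (simp add: sum_distrib_right right_diff_distrib sum_subtractf)
qed

lemma diag_mat_apply: "(diag_mat k *v v) $ i = k $ i * v $ i"
  by (simp add: diag_mat_def matrix_vector_mult_def if_distrib[of "\<lambda>a. a * _"] cong: if_cong)

lemma matrix_vector_mult_minus_left: "(- M) *v v = - (M *v v)" for M :: "real ^ 'n ^ 'm"
  by (simp add: matrix_vector_mult_def vec_eq_iff sum_negf)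

text \<open>As long as the plant output vanishes, the feedback terms \<open>B K\<^sup>P C\<close> and \<open>- C\<close> vanish too, so the
  closed loop reproduces the motion of the plant and the integral states remain at zero. All powers
  of \<open>A\<close> enter, since the closed loop has larger dimension than the plant.\<close>

lemma plant_unobservable_closed_loop:
  fixes A :: "real ^ 'n ^ 'n" and B :: "real ^ 'm ^ 'n" and C :: "real ^ 'n ^ 'm"
  assumes w: "w \<in> unobservable_subspace A C"
  shows "vjoin w 0 \<in> unobservable_subspace (closed_loop_matrix A B C kP kI \<gamma> L) (block_row C (0 :: real ^ 'm ^ 'm))"
proof -
  have Cw: "C *v ((*v) A ^^ j) w = 0" for j
    by (rule unobservable_all_powers[OF w])
  have "((*v) (closed_loop_matrix A B C kP kI \<gamma> L) ^^ j) (vjoin w 0) = vjoin (((*v) A ^^ j) w) 0" for j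
    by (induction j)
      (simp_all add: closed_loop_matrix_def block_mat_vjoin matrix_vector_mult_diff_rdistrib Cw
        matrix_vector_mul_assoc[symmetric] matrix_vector_mult_minus_left)
  then show ?thesis
    by (simp add: unobservable_subspace_def block_row_vjoin Cw)
qed

theorem theorem2:
  fixes A :: "real ^ 'n ^ 'n" and B :: "real ^ 'm ^ 'n" and C :: "real ^ 'n ^ 'm"
    and E :: "('m \<times> 'm) set" and c :: "'m \<Rightarrow> 'm \<Rightarrow> real"
    and kP kI r :: "real ^ 'm" and \<gamma> :: real and d0 :: "real ^ 'n"
    and x d :: "real \<Rightarrow> real ^ 'n" and u y z \<eta> :: "real \<Rightarrow> real ^ 'm"
  assumes "connected_graph E"
    and "\<And>i j. j \<in> nbrs E i \<Longrightarrow> c i j = c j i \<and> c i j > 0"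
    and "\<And>i. kP $ i > 0" and "\<And>i. kI $ i > 0" and "\<gamma> > 0"
    and "plant A B C d \<eta> x u y"
    and "distributed_controller E c \<gamma> kP kI r y z u"
    and "output_stable A B C kP kI \<gamma> (weighted_laplacian E c)"
    and "\<And>t. t \<ge> 0 \<Longrightarrow> \<eta> t = 0"
    and "\<And>t. t \<ge> 0 \<Longrightarrow> d t = d0"
    and "\<exists>(k::real) (xs :: real ^ 'n).
           A *v xs - k *\<^sub>R ((B ** diag_mat kI) *v (\<chi> i. 1)) + d0 \<in> unobservable_subspace A C
           \<and> C *v xs = r"
  shows "((\<lambda>t. r - y t) \<longlongrightarrow> 0) at_top"
proof -
  let ?L = "weighted_laplacian E c"
  let ?F = "closed_loop_matrix A B C kP kI \<gamma> ?L"
  let ?H = "block_row C (0 :: real ^ 'm ^ 'm)"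
  let ?one = "(\<chi> i. 1) :: real ^ 'm"
  obtain k xs where w: "A *v xs - k *\<^sub>R ((B ** diag_mat kI) *v ?one) + d0 \<in> unobservable_subspace A C"
    and r: "C *v xs = r"
    using assms(11) by blast
  define w where "w = A *v xs - k *\<^sub>R ((B ** diag_mat kI) *v ?one) + d0"
  define W where "W t = vjoin (x t - xs) (z t + k *\<^sub>R ?one)" for t
  have y: "y t = C *v x t" if "t \<ge> 0" for t
    using assms(6,9) that by (simp add: plant_def)
  have "irrefl E" using assms(1) by (simp add: connected_graph_def)
  have "(W has_vector_derivative (?F *v W t + vjoin w 0)) (at t within {0..})" if t: "t \<ge> 0" for t
  proof -
    have u: "u t = diag_mat kP *v (r - y t) + diag_mat kI *v z t"
      using assms(7) t by (simp add: distributed_controller_def vec_eq_iff diag_mat_apply)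
    \<comment> \<open>The common shift of the integral states is invisible to the Laplacian.\<close>
    have "(z has_vector_derivative (r - y t - \<gamma> *\<^sub>R (?L *v (z t + k *\<^sub>R ?one)))) (at t within {0..})"
    proof (rule vec_has_vector_derivative)
      fix i
      show "((\<lambda>s. z s $ i) has_real_derivative (r - y t - \<gamma> *\<^sub>R (?L *v (z t + k *\<^sub>R ?one))) $ i) (at t within {0..})"
        using assms(7) t
        by (simp add: distributed_controller_def weighted_laplacian_apply[OF \<open>irrefl E\<close>])
    qed
    then have dz: "((\<lambda>t. z t + k *\<^sub>R ?one) has_vector_derivative
        (r - y t - \<gamma> *\<^sub>R (?L *v (z t + k *\<^sub>R ?one)))) (at t within {0..})"
      by (auto intro!: derivative_eq_intros)
    have "(x has_vector_derivative (A *v x t + B *v u t + d0)) (at t within {0..})"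
      using assms(6,10) t by (simp add: plant_def)
    then have dx: "((\<lambda>t. x t - xs) has_vector_derivative (A *v x t + B *v u t + d0)) (at t within {0..})"
      by (auto intro!: derivative_eq_intros)
    have "?F *v W t + vjoin w 0 = vjoin (A *v x t + B *v u t + d0) (r - y t - \<gamma> *\<^sub>R (?L *v (z t + k *\<^sub>R ?one)))"
      unfolding W_def closed_loop_matrix_def block_mat_vjoin vjoin_add w_def u y[OF t] r[symmetric]
      by (simp add: matrix_vector_right_distrib matrix_vector_mult_diff_distrib matrix_vector_mult_diff_rdistrib
          matrix_vector_mult_minus_left matrix_vector_mult_scaleR matrix_vector_mul_assoc[symmetric] scaleR_matrix_vector_assoc[symmetric] algebra_simps)
    then show ?thesis
      unfolding W_def using vjoin_has_vector_derivative[OF dx dz] by simp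
  qed
  then have "((\<lambda>t. ?H *v W t) \<longlongrightarrow> 0) at_top"
    using assms(8) plant_unobservable_closed_loop w
    unfolding output_stable_def w_def[symmetric]
    by (intro observable_output_decay[where g = "\<lambda>_. vjoin w 0"]) auto
  then have "((\<lambda>t. - (?H *v W t)) \<longlongrightarrow> 0) at_top"
    using tendsto_minus by fastforce
  moreover have "eventually (\<lambda>t. - (?H *v W t) = r - y t) at_top"
    using eventually_ge_at_top[of 0]
    by eventually_elim (simp add: W_def block_row_vjoin y r[symmetric] matrix_vector_mult_diff_distrib)
  ultimately show ?thesis
    by (rule Lim_transform_eventually)
qed

end
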